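(* Let $k$ be a positive integer, let $S$ be a finite set, and let $\varphi\colon 2^S\to\mathbb{R}$ be a polymatroid function which is $k$-tensor-compatible with the rank function of the uniform matroid $U_{2,3}$. Then $\varphi$ is $k$-fractionally modular extendable.
   Context: Ground sets are finite. A polymatroid function is a set function $\varphi\colon 2^S\to\mathbb{R}$ that is increasing ($X\subseteq Y$ implies $\varphi(X)\le\varphi(Y)$), submodular ($\varphi(X)+\varphi(Y)\ge\varphi(X\cap Y)+\varphi(X\cup Y)$) and satisfies $\varphi(\emptyset)=0$. $U_{2,3}$ is the rank-$2$ uniform matroid on three elements; its rank function is $X\mapsto\min\{|X|,2\}$. A tensor product of polymatroid functions $\varphi_1\colon 2^{S_1}\to\mathbb{R}$ and $\varphi_2\colon 2^{S_2}\to\mathbb{R}$ is a polymatroid function $\varphi\colon 2^{S_1\times S_2}\to\mathbb{R}$ (not necessarily integer-valued) with $\varphi(X_1\times X_2)=\varphi_1(X_1)\varphi_2(X_2)$ for all $X_1\subseteq S_1$, $X_2\subseteq S_2$; the set of these is denoted $\varphi_1\otimes\varphi_2$. Let $T_1(\varphi,\psi)=\varphi\otimes\psi$ and $T_k(\varphi,\psi)=\bigcup_{\varphi'\in T_{k-1}(\varphi,\psi)}\varphi'\otimes\psi$ for $k\ge2$. $\varphi$ is $k$-tensor-compatible with $\psi$ if $T_k(\varphi,\psi)\ne\emptyset$. For a polymatroid function $\varphi\colon 2^S\to\mathbb{R}$ and $A,B\subseteq S$, an extension step with respect to $A$ and $B$ results in a polymatroid function $\varphi'\colon 2^{S'}\to\mathbb{R}$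 with $S\subseteq S'$ such that $\varphi'(X)=\varphi(X)$ for all $X\subseteq S$ and there is $Z\subseteq S'$ with $\varphi'(A\cup Z)=\varphi(A)$, $\varphi'(B\cup Z)=\varphi(B)$, $\varphi'(Z)=\varphi(A)+\varphi(B)-\varphi(A\cup B)$. Every polymatroid function is $0$-fractionally modular extendable; for $k\ge1$, $\varphi$ is $k$-fractionally modular extendable if for all $A,B\subseteq S$ there is a $(k-1)$-fractionally modular extendable polymatroid function obtained from $\varphi$ by an extension step with respect to $A$ and $B$. *)

theory Defs
  imports Complex_Main
begin

text \<open>
  A set function \<open>2^S \<rightarrow> \<real>\<close> is represented by a ground set \<open>S\<close> together with a function on all
  sets of the ambient type; only its values on subsets of \<open>S\<close> are ever constrained or used.
\<close>

definition polymatroid :: "'a set \<Rightarrow> ('a set \<Rightarrow> real) \<Rightarrow> bool" where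
  "polymatroid S \<phi> \<longleftrightarrow>
     finite S \<and>
     \<phi> {} = 0 \<and>
     (\<forall>X Y. X \<subseteq> Y \<and> Y \<subseteq> S \<longrightarrow> \<phi> X \<le> \<phi> Y) \<and>
     (\<forall>X Y. X \<subseteq> S \<and> Y \<subseteq> S \<longrightarrow> \<phi> X + \<phi> Y \<ge> \<phi> (X \<inter> Y) + \<phi> (X \<union> Y))"

definition uniform_rank :: "nat \<Rightarrow> 'a set \<Rightarrow> real" where
  "uniform_rank r X = real (min (card X) r)"

definition tensor_products ::
    "'a set \<Rightarrow> ('a set \<Rightarrow> real) \<Rightarrow> 'b set \<Rightarrow> ('b set \<Rightarrow> real) \<Rightarrow> (('a \<times> 'b) set \<Rightarrow> real) set" where
  "tensor_products S\<^sub>1 \<phi>\<^sub>1 S\<^sub>2 \<phi>\<^sub>2 =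
     {\<phi>. polymatroid (S\<^sub>1 \<times> S\<^sub>2) \<phi> \<and>
         (\<forall>X\<^sub>1 X\<^sub>2. X\<^sub>1 \<subseteq> S\<^sub>1 \<and> X\<^sub>2 \<subseteq> S\<^sub>2 \<longrightarrow> \<phi> (X\<^sub>1 \<times> X\<^sub>2) = \<phi>\<^sub>1 X\<^sub>1 * \<phi>\<^sub>2 X\<^sub>2)}"

text \<open>
  The ground set of a member of \<open>T\<^sub>k\<close> is \<open>(\<dots>((S \<times> E) \<times> E) \<dots>) \<times> E\<close>, whose HOL type would depend on
  \<open>k\<close>. The following type contains all these left-nested products: \<open>Snoc (Snoc (Base s) e) e'\<close> stands
  for \<open>((s, e), e')\<close>.
\<close>

datatype ('a, 'b) nested = Base 'a | Snoc "('a, 'b) nested" 'b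

primrec iterated_ground :: "nat \<Rightarrow> 'a set \<Rightarrow> 'b set \<Rightarrow> ('a, 'b) nested set" where
  "iterated_ground 0 S E = Base ` S"
| "iterated_ground (Suc k) S E = (\<lambda>(x, e). Snoc x e) ` (iterated_ground k S E \<times> E)"

text \<open>
  A set function \<open>g\<close> on \<open>iterated_ground (Suc k) S E\<close> is regarded as one on
  \<open>iterated_ground k S E \<times> E\<close> by relabelling along the injective map \<open>(x, e) \<mapsto> Snoc x e\<close>.
  The recursion starts at \<open>T\<^sub>0(\<phi>, \<psi>) = {\<phi>}\<close> (up to the relabelling \<open>Base\<close>), which gives
  \<open>T\<^sub>1(\<phi>, \<psi>) = \<phi> \<otimes> \<psi>\<close>.
\<close>

primrec iterated_tensor_products ::
    "nat \<Rightarrow> 'a set \<Rightarrow> ('a set \<Rightarrow> real) \<Rightarrow> 'b set \<Rightarrow> ('b set \<Rightarrow> real) \<Rightarrow> (('a, 'b) nested set \<Rightarrow> real) set" where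
  "iterated_tensor_products 0 S \<phi> E \<psi> = {g. \<forall>X\<subseteq>S. g (Base ` X) = \<phi> X}"
| "iterated_tensor_products (Suc k) S \<phi> E \<psi> =
     (\<Union>\<phi>' \<in> iterated_tensor_products k S \<phi> E \<psi>.
        {g. (\<lambda>X. g ((\<lambda>(x, e). Snoc x e) ` X)) \<in> tensor_products (iterated_ground k S E) \<phi>' E \<psi>})"

definition tensor_compatible ::
    "nat \<Rightarrow> 'a set \<Rightarrow> ('a set \<Rightarrow> real) \<Rightarrow> 'b set \<Rightarrow> ('b set \<Rightarrow> real) \<Rightarrow> bool" where
  "tensor_compatible k S \<phi> E \<psi> \<longleftrightarrow> iterated_tensor_products k S \<phi> E \<psi> \<noteq> {}"

lemma tensor_compatible_1_iff:
  "tensor_compatible 1 S \<phi> E \<psi> \<longleftrightarrow> tensor_products S \<phi> E \<psi> \<noteq> {}"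
proof
  let ?B = "Base ` S :: ('a, 'b) nested set"
  let ?b = "\<lambda>(x, e). Snoc (Base x) e :: ('a, 'b) nested"
  let ?h = "\<lambda>(x::'a, e::'b). (Base x :: ('a, 'b) nested, e)"
  have ih: "inj ?h" by (auto simp: inj_def)
  have prodh: "?h ` (X \<times> Y) = Base ` X \<times> Y" for X :: "'a set" and Y :: "'b set"
    by force
  {
    assume "tensor_compatible 1 S \<phi> E \<psi>"
    then obtain g \<phi>' where 0: "\<forall>X\<subseteq>S. \<phi>' (Base ` X) = \<phi> X"
      and 1: "(\<lambda>X. g ((\<lambda>(x, e). Snoc x e) ` X)) \<in> tensor_products ?B \<phi>' E \<psi>"
      by (auto simp: tensor_compatible_def)
    define f where "f = (\<lambda>X. g ((\<lambda>(x, e). Snoc x e) ` X))"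
    have p: "polymatroid (?B \<times> E) f"
      and t: "\<And>X Y. X \<subseteq> Base ` S \<Longrightarrow> Y \<subseteq> E \<Longrightarrow> f (X \<times> Y) = \<phi>' X * \<psi> Y"
      using 1 unfolding f_def[symmetric] tensor_products_def by auto
    have "finite (S \<times> E)"
    proof -
      have "finite (?h ` (S \<times> E))" using p unfolding prodh polymatroid_def by simp
      then show ?thesis using ih by (metis finite_imageD inj_on_subset subset_UNIV)
    qed
    moreover have "?h ` X \<subseteq> ?B \<times> E" if "X \<subseteq> S \<times> E" for X
      using that by auto
    ultimately have "polymatroid (S \<times> E) (\<lambda>X. f (?h ` X))"
      using p unfolding polymatroid_def by (simp add: image_Int[OF ih] image_Un image_mono)
    moreover have "f (?h ` (X \<times> Y)) = \<phi> X * \<psi> Y" if "X \<subseteq> S" "Y \<subseteq> E" for X Y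
      unfolding prodh using t[of "Base ` X" Y] 0 that by (simp add: image_mono)
    ultimately show "tensor_products S \<phi> E \<psi> \<noteq> {}"
      unfolding tensor_products_def by blast
  }
  {
    assume "tensor_products S \<phi> E \<psi> \<noteq> {}"
    then obtain f where p: "polymatroid (S \<times> E) f"
      and t: "\<And>X Y. X \<subseteq> S \<Longrightarrow> Y \<subseteq> E \<Longrightarrow> f (X \<times> Y) = \<phi> X * \<psi> Y"
      unfolding tensor_products_def by auto
    define \<phi>' where "\<phi>' = (\<lambda>X. \<phi> ((Base :: 'a \<Rightarrow> ('a, 'b) nested) -` X))"
    define g where "g = (\<lambda>X. f (?b -` X))"
    have iB: "inj (Base :: 'a \<Rightarrow> ('a, 'b) nested)" by (auto simp: inj_def)
    have 0: "\<forall>X\<subseteq>S. \<phi>' (Base ` X) = \<phi> X"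
      unfolding \<phi>'_def by (simp add: inj_vimage_image_eq[OF iB])
    have e: "g ((\<lambda>(x, e). Snoc x e) ` X) = f (?h -` X)" for X
      unfolding g_def by (rule arg_cong[of _ _ f]) force
    have s: "?h -` X \<subseteq> S \<times> E" if "X \<subseteq> ?B \<times> E" for X
      using that by auto
    have pp: "polymatroid (?B \<times> E) (\<lambda>X. f (?h -` X))"
    proof -
      have "finite (?h ` (S \<times> E))" using p unfolding polymatroid_def by blast
      then have "finite (?B \<times> E)" unfolding prodh .
      then show ?thesis using p s unfolding polymatroid_def
        by (simp add: vimage_mono)
    qed
    have "f (?h -` (X \<times> Y)) = \<phi>' X * \<psi> Y" if "X \<subseteq> ?B" "Y \<subseteq> E" for X Y
    proof -
      have "?h -` (X \<times> Y) = (Base -` X) \<times> Y" by auto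
      moreover have "Base -` X \<subseteq> S" using that by auto
      ultimately show ?thesis using t that by (simp add: \<phi>'_def)
    qed
    with pp have "(\<lambda>X. g ((\<lambda>(x, e). Snoc x e) ` X)) \<in> tensor_products ?B \<phi>' E \<psi>"
      unfolding e tensor_products_def by blast
    with 0 show "tensor_compatible 1 S \<phi> E \<psi>"
      unfolding tensor_compatible_def by auto
  }
qed

definition extension_step ::
    "'a set \<Rightarrow> ('a set \<Rightarrow> real) \<Rightarrow> 'a set \<Rightarrow> 'a set \<Rightarrow> 'a set \<Rightarrow> ('a set \<Rightarrow> real) \<Rightarrow> bool" where
  "extension_step S \<phi> A B S' \<phi>' \<longleftrightarrow>
     polymatroid S' \<phi>' \<and> S \<subseteq> S' \<and> (\<forall>X\<subseteq>S. \<phi>' X = \<phi> X) \<and>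
     (\<exists>Z\<subseteq>S'. \<phi>' (A \<union> Z) = \<phi> A \<and> \<phi>' (B \<union> Z) = \<phi> B \<and> \<phi>' Z = \<phi> A + \<phi> B - \<phi> (A \<union> B))"

text \<open>
  In the next definition all extensions live in the ambient type \<open>'a\<close>, so it is only meaningful if
  \<open>'a\<close> is infinite, that is, if there are always enough fresh elements.
\<close>

primrec frac_modular_extendable_in :: "nat \<Rightarrow> 'a set \<Rightarrow> ('a set \<Rightarrow> real) \<Rightarrow> bool" where
  "frac_modular_extendable_in 0 S \<phi> \<longleftrightarrow> polymatroid S \<phi>"
| "frac_modular_extendable_in (Suc k) S \<phi> \<longleftrightarrow>
     polymatroid S \<phi> \<and>
     (\<forall>A B. A \<subseteq> S \<and> B \<subseteq> S \<longrightarrow>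
        (\<exists>S' \<phi>'. extension_step S \<phi> A B S' \<phi>' \<and> frac_modular_extendable_in k S' \<phi>'))"

text \<open>
  To allow an arbitrary type \<open>'a\<close>, \<open>S\<close> is first embedded into \<open>'a + nat\<close>. As ground sets are finite
  and the notion is invariant under relabelling, every extension can be realised there.
\<close>

definition frac_modular_extendable :: "nat \<Rightarrow> 'a set \<Rightarrow> ('a set \<Rightarrow> real) \<Rightarrow> bool" where
  "frac_modular_extendable k S \<phi> \<longleftrightarrow>
     frac_modular_extendable_in k (Inl ` S :: ('a + nat) set) (\<lambda>X. \<phi> (Inl -` X))"

end

theory Submission
  imports Defs
begin

text \<open>
  Consider one tensor product \<open>\<psi> \<in> \<phi> \<otimes> U\<close> with \<open>U = U\<^sub>2\<^sub>,\<^sub>3\<close> on \<open>E = {a, b, c}\<close>. If \<open>\<phi>\<close> comes from a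
  vector space \<open>V\<close>, then \<open>\<psi>\<close> lives in \<open>V \<oplus> V\<close>, where the layers \<open>a\<close>, \<open>b\<close>, \<open>c\<close> are \<open>V \<oplus> 0\<close>, \<open>0 \<oplus> V\<close> and
  the diagonal. The diagonal is a copy of \<open>V\<close>, and it meets \<open>W = A \<times> {a} \<union> B \<times> {b}\<close>, that is \<open>A \<oplus> B\<close>,
  exactly in the copy of \<open>A \<inter> B\<close>. Hence adding \<open>A \<inter> B\<close> to \<open>X \<subseteq> V\<close> raises the rank to
  \<open>\<psi> (X \<times> {c} \<union> W) - \<phi> (A \<union> B)\<close>. This formula makes sense for every \<open>\<psi>\<close>, and it defines an extension of \<open>\<phi>\<close>
  by one element \<open>z\<close> that is a valid extension step with respect to \<open>A\<close> and \<open>B\<close>. The required values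
  follow from two properties of \<open>\<psi>\<close>: two layers are independent of each other
  (\<open>tensor_layers_modular\<close>), and together they span the third (\<open>tensor_two_layers_span\<close>).

  It remains to see that the extended function can be extended further. It arises from \<open>\<psi>\<close> by two
  operations: elements are replaced by sets of elements (aggregation), and the constant
  \<open>d = \<phi> (A \<union> B)\<close> is subtracted from the value of every set that contains \<open>z\<close>. Such reduced aggregates
  inherit fractional modular extendability
  (\<open>frac_modular_extendable_in_reduced_aggregate\<close>): an extension step for the original function is
  carried over by adding the set \<open>Z\<close> as a single new element. Therefore, if \<open>\<psi>\<close> is
  \<open>n\<close>-fractionally modular extendable, then \<open>\<phi>\<close> is so with \<open>n + 1\<close> in place of \<open>n\<close>
  (\<open>tensor_factor_frac_modular_extendable_in\<close>). A member of \<open>T\<^sub>k(\<phi>, U)\<close> is polymatroid, that is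
  \<open>0\<close>-extendable, and stripping off its \<open>k\<close> factors \<open>U\<close> one by one, the last one first, gives the
  claim for \<open>\<phi>\<close>.
\<close>

section \<open>Polymatroid functions\<close>

lemma polymatroid_mono: "polymatroid S f \<Longrightarrow> X \<subseteq> Y \<Longrightarrow> Y \<subseteq> S \<Longrightarrow> f X \<le> f Y"
  unfolding polymatroid_def by blast

lemma polymatroid_submodular:
  "polymatroid S f \<Longrightarrow> X \<subseteq> S \<Longrightarrow> Y \<subseteq> S \<Longrightarrow> f (X \<inter> Y) + f (X \<union> Y) \<le> f X + f Y"
  unfolding polymatroid_def by blast

lemma polymatroid_diminishing:
  assumes "polymatroid S f" "X \<subseteq> Y" "Y \<subseteq> S" "Z \<subseteq> S"
  shows "f (Y \<union> Z) - f Y \<le> f (X \<union> Z) - f X"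
proof -
  have "f ((X \<union> Z) \<inter> Y) + f ((X \<union> Z) \<union> Y) \<le> f (X \<union> Z) + f Y"
    using assms by (intro polymatroid_submodular[of S f]) auto
  moreover have "f X \<le> f ((X \<union> Z) \<inter> Y)"
    using assms by (intro polymatroid_mono[of S f]) auto
  moreover have "X \<union> Z \<union> Y = Y \<union> Z" using assms by auto
  ultimately show ?thesis by simp
qed

lemma polymatroid_spans_mono:
  assumes "polymatroid S f" "X \<subseteq> Y" "Y \<subseteq> S" "Z \<subseteq> S" "f (X \<union> Z) = f X"
  shows "f (Y \<union> Z) = f Y"
  using polymatroid_diminishing[OF assms(1-4)] assms(5) polymatroid_mono[OF assms(1), of Y "Y \<union> Z"]
    assms(3,4) by fastforce

lemma frac_modular_extendable_in_polymatroid: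
  "frac_modular_extendable_in n S f \<Longrightarrow> polymatroid S f"
  by (cases n) auto

section \<open>Reduced aggregates\<close>

text \<open>
  \<open>h\<close> is the aggregate of \<open>f\<close> along \<open>N\<close>, with every set that meets \<open>D\<close> lowered by \<open>d\<close>. In linear terms
  this is a contraction by a generic \<open>d\<close>-dimensional subspace of the span of \<open>C\<close>: it lies in the span
  of every element of \<open>D\<close> and is independent of the elements outside \<open>D\<close>. Two conditions keep \<open>h\<close> polymatroid: each element of \<open>D\<close> spans \<open>C\<close>, and the
  elements outside \<open>D\<close>, even all together, leave at least \<open>d\<close> of the rank of \<open>C\<close> uncovered. A whole
  set \<open>D\<close> rather than one reduced element is needed because later extension steps add new elements
  that contain \<open>C\<close> in their span and must be lowered along with the old ones.
\<close>

definition reduced_aggregate ::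
    "'b set \<Rightarrow> ('b set \<Rightarrow> real) \<Rightarrow> 'c set \<Rightarrow> ('c \<Rightarrow> 'b set) \<Rightarrow> 'c set \<Rightarrow> 'b set \<Rightarrow> real
      \<Rightarrow> ('c set \<Rightarrow> real) \<Rightarrow> bool" where
  "reduced_aggregate T f G N D C d h \<longleftrightarrow>
     finite G \<and> (\<forall>x\<in>G. N x \<subseteq> T) \<and> D \<subseteq> G \<and> C \<subseteq> T \<and>
     (\<forall>y\<in>D. f (N y \<union> C) = f (N y)) \<and>
     f (\<Union>(N ` (G - D))) + d \<le> f (\<Union>(N ` (G - D)) \<union> C) \<and>
     (\<forall>X\<subseteq>G. h X = f (\<Union>(N ` X)) - d * of_bool (X \<inter> D \<noteq> {}))"

lemma reduced_aggregate_spans: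
  assumes "polymatroid T f" "reduced_aggregate T f G N D C d h" "X \<subseteq> G" "X \<inter> D \<noteq> {}"
  shows "f (\<Union>(N ` X) \<union> C) = f (\<Union>(N ` X))"
proof -
  obtain y where y: "y \<in> X" "y \<in> D" using assms(4) by auto
  show ?thesis
    by (rule polymatroid_spans_mono[OF assms(1), of "N y"])
      (use assms(2,3) y in \<open>auto simp: reduced_aggregate_def\<close>)
qed

lemma reduced_aggregate_gain:
  assumes "polymatroid T f" "reduced_aggregate T f G N D C d h" "P \<subseteq> \<Union>(N ` (G - D))"
  shows "f P + d \<le> f (P \<union> C)"
proof -
  have "f (\<Union>(N ` (G - D)) \<union> C) - f (\<Union>(N ` (G - D))) \<le> f (P \<union> C) - f P"
    by (rule polymatroid_diminishing[OF assms(1)])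
      (use assms(2,3) in \<open>auto simp: reduced_aggregate_def\<close>)
  then show ?thesis using assms(2) by (auto simp: reduced_aggregate_def)
qed

text \<open>
  Subtracting \<open>d\<close> can break submodularity only for two sets that meet \<open>D\<close> while their intersection
  does not, and monotonicity for \<open>d > 0\<close> only when a set that misses \<open>D\<close> is enlarged to one that
  meets it. In both cases \<open>C\<close> comes for free in the sets that meet \<open>D\<close>, while it adds at least \<open>d\<close>
  to the one that does not.
\<close>

lemma polymatroid_reduced_aggregate:
  assumes f: "polymatroid T f" and r: "reduced_aggregate T f G N D C d h"
  shows "polymatroid G h"
proof -
  let ?U = "\<lambda>X. \<Union>(N ` X)"
  let ?i = "\<lambda>X. of_bool (X \<inter> D \<noteq> {}) :: real"
  have h: "h X = f (?U X) - d * ?i X" if "X \<subseteq> G" for X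
    using r that by (auto simp: reduced_aggregate_def)
  have UT: "?U X \<subseteq> T" if "X \<subseteq> G" for X
    using r that unfolding reduced_aggregate_def by blast
  have C: "C \<subseteq> T" using r by (simp add: reduced_aggregate_def)
  have gain: "f (?U X) + d \<le> f (?U X \<union> C)" if "X \<subseteq> G" "X \<inter> D = {}" for X
    by (rule reduced_aggregate_gain[OF f r]) (use that in auto)
  have mono: "h X \<le> h Y" if "X \<subseteq> Y" "Y \<subseteq> G" for X Y
  proof (cases "X \<inter> D = {} \<and> Y \<inter> D \<noteq> {}")
    case True
    have "f (?U X) + d \<le> f (?U X \<union> C)" using gain True that by auto
    also have "\<dots> \<le> f (?U Y \<union> C)"
      using that UT[of Y] C by (intro polymatroid_mono[OF f]) auto
    also have "\<dots> = f (?U Y)" using reduced_aggregate_spans[OF f r] True that by auto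
    finally show ?thesis using h that True by auto
  next
    case False
    have "f (?U X) \<le> f (?U Y)" using that UT[of Y] by (intro polymatroid_mono[OF f]) auto
    moreover have "?i X = ?i Y" using False that by auto
    ultimately show ?thesis using h that by auto
  qed
  have sub: "h (X \<inter> Y) + h (X \<union> Y) \<le> h X + h Y" if X: "X \<subseteq> G" and Y: "Y \<subseteq> G" for X Y
  proof -
    have XY: "X \<inter> Y \<subseteq> G" "X \<union> Y \<subseteq> G" using X Y by auto
    have U: "?U (X \<union> Y) = ?U X \<union> ?U Y" by auto
    show ?thesis
    proof (cases "X \<inter> D \<noteq> {} \<and> Y \<inter> D \<noteq> {} \<and> X \<inter> Y \<inter> D = {}")
      case True
      \<comment> \<open>Both sets span \<open>C\<close>, so \<open>C\<close> can be added to them and survives in the intersection.\<close>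
      have "f (?U (X \<inter> Y)) + d \<le> f (?U (X \<inter> Y) \<union> C)" using gain True XY by auto
      also have "\<dots> \<le> f ((?U X \<union> C) \<inter> (?U Y \<union> C))"
        using UT[OF X] C by (intro polymatroid_mono[OF f]) auto
      finally have "f (?U (X \<inter> Y)) + d + f ((?U X \<union> C) \<union> (?U Y \<union> C))
          \<le> f (?U X \<union> C) + f (?U Y \<union> C)"
        using polymatroid_submodular[OF f, of "?U X \<union> C" "?U Y \<union> C"] UT[OF X] UT[OF Y] C by auto
      moreover have "f (?U (X \<union> Y)) \<le> f ((?U X \<union> C) \<union> (?U Y \<union> C))"
        using UT[OF X] UT[OF Y] C by (intro polymatroid_mono[OF f]) auto
      moreover have "f (?U X \<union> C) = f (?U X)" "f (?U Y \<union> C) = f (?U Y)"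
        using reduced_aggregate_spans[OF f r] True X Y by auto
      moreover have "?i X = 1" "?i Y = 1" "?i (X \<union> Y) = 1" "?i (X \<inter> Y) = 0"
        using True by auto
      ultimately show ?thesis unfolding h[OF X] h[OF Y] h[OF XY(1)] h[OF XY(2)] by simp
    next
      case False
      have "f (?U (X \<inter> Y)) \<le> f (?U X \<inter> ?U Y)"
        using UT[OF X] by (intro polymatroid_mono[OF f]) auto
      then have "f (?U (X \<inter> Y)) + f (?U (X \<union> Y)) \<le> f (?U X) + f (?U Y)"
        using polymatroid_submodular[OF f UT[OF X] UT[OF Y]] unfolding U by linarith
      moreover have "?i (X \<inter> Y) + ?i (X \<union> Y) = ?i X + ?i Y" using False by auto
      then have "d * ?i (X \<inter> Y) + d * ?i (X \<union> Y) = d * ?i X + d * ?i Y"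
        by (metis distrib_left)
      ultimately show ?thesis unfolding h[OF X] h[OF Y] h[OF XY(1)] h[OF XY(2)] by linarith
    qed
  qed
  have "h {} = 0" using h[of "{}"] f by (simp add: polymatroid_def)
  moreover have "finite G" using r by (simp add: reduced_aggregate_def)
  ultimately show ?thesis using mono sub unfolding polymatroid_def by blast
qed

text \<open>
  The set \<open>Z\<close> of an extension step for \<open>f\<close> becomes a single new element \<open>z\<close>. What has to be decided is
  whether \<open>z\<close> is lowered by \<open>d\<close>. The prescribed value \<open>h A + h B - h (A \<union> B)\<close> is smaller by \<open>d\<close> than
  its counterpart for \<open>f\<close> if both \<open>A\<close> and \<open>B\<close> meet \<open>D\<close>, and equal to it otherwise. In the first case \<open>C\<close> is spanned by both sets, so it can be added to \<open>Z\<close>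
  without changing any of the relevant values, and then \<open>z\<close> may join \<open>D\<close>. Otherwise \<open>Z\<close> is spanned by
  elements outside \<open>D\<close>, and \<open>z\<close> may stay outside as well.
\<close>

lemma extension_step_reduced_aggregate:
  assumes f: "polymatroid T f" and r: "reduced_aggregate T f G N D C d h"
    and A: "A \<subseteq> G" and B: "B \<subseteq> G" and z: "z \<notin> G"
    and f': "polymatroid T' f'" "T \<subseteq> T'" "\<And>X. X \<subseteq> T \<Longrightarrow> f' X = f X"
    and Z: "Z \<subseteq> T'" "f' (\<Union>(N ` A) \<union> Z) = f (\<Union>(N ` A))" "f' (\<Union>(N ` B) \<union> Z) = f (\<Union>(N ` B))"
      "f' Z = f (\<Union>(N ` A)) + f (\<Union>(N ` B)) - f (\<Union>(N ` (A \<union> B)))"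
  shows "\<exists>N' D' h'. reduced_aggregate T' f' (insert z G) N' D' C d h' \<and>
     extension_step G h A B (insert z G) h'"
proof -
  let ?U = "\<lambda>X. \<Union>(N ` X)"
  define both where "both \<longleftrightarrow> A \<inter> D \<noteq> {} \<and> B \<inter> D \<noteq> {}"
  define Z' where "Z' = (if both then Z \<union> C else Z)"
  define N' where "N' = N(z := Z')"
  define D' where "D' = (if both then insert z D else D)"
  define h' where "h' X = f' (\<Union>(N' ` X)) - d * of_bool (X \<inter> D' \<noteq> {})" for X
  have D: "D \<subseteq> G" "z \<notin> D" and C: "C \<subseteq> T" and fin: "finite G"
    and NT: "\<And>x. x \<in> G \<Longrightarrow> N x \<subseteq> T"
    and h: "\<And>X. X \<subseteq> G \<Longrightarrow> h X = f (?U X) - d * of_bool (X \<inter> D \<noteq> {})"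
    and span: "\<And>y. y \<in> D \<Longrightarrow> f (N y \<union> C) = f (N y)"
    and gain: "f (?U (G - D)) + d \<le> f (?U (G - D) \<union> C)"
    using r z by (auto simp: reduced_aggregate_def)
  have UT: "?U X \<subseteq> T" if "X \<subseteq> G" for X using NT that by blast
  have N': "N' ` X = N ` X" if "X \<subseteq> G" for X
    unfolding N'_def using that z by (auto intro!: image_cong)
  have N'z: "\<Union>(N' ` (X \<union> {z})) = ?U X \<union> Z'" if "X \<subseteq> G" for X
    unfolding image_Un N'[OF that] by (simp add: N'_def Un_commute)
  have Z'T: "Z' \<subseteq> T'" using Z(1) C f'(2) by (auto simp: Z'_def)
  have spanZ: "f' (?U X \<union> Z') = f (?U X)"
    if X: "X \<subseteq> G" "f' (?U X \<union> Z) = f (?U X)" and XD: "both \<Longrightarrow> X \<inter> D \<noteq> {}" for X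
  proof (cases both)
    case True
    have "f' (?U X \<union> C) = f' (?U X)"
      using reduced_aggregate_spans[OF f r X(1) XD[OF True]] f'(3) UT[OF X(1)] C by simp
    then have "f' (?U X \<union> Z \<union> C) = f' (?U X \<union> Z)"
      by (rule polymatroid_spans_mono[OF f'(1), rotated -1])
        (use UT[OF X(1)] C f'(2) Z(1) in auto)
    then show ?thesis using X(2) True by (simp add: Z'_def Un_assoc)
  next
    case False then show ?thesis using X(2) by (simp add: Z'_def)
  qed
  have sA: "f' (?U A \<union> Z') = f (?U A)" and sB: "f' (?U B \<union> Z') = f (?U B)"
    using spanZ A B Z both_def by auto
  \<comment> \<open>\<open>Z\<close> already has the largest rank that a common part of the two spans can have.\<close>
  have vZ: "f' Z' = f (?U A) + f (?U B) - f (?U (A \<union> B))"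
  proof (rule antisym)
    have "f' ((?U A \<union> Z') \<inter> (?U B \<union> Z')) + f' ((?U A \<union> Z') \<union> (?U B \<union> Z')) \<le> f (?U A) + f (?U B)"
      using polymatroid_submodular[OF f'(1), of "?U A \<union> Z'" "?U B \<union> Z'"] sA sB UT[OF A] UT[OF B] Z'T f'(2)
      by auto
    moreover have "f' Z' \<le> f' ((?U A \<union> Z') \<inter> (?U B \<union> Z'))"
      using UT[OF A] Z'T f'(2) by (intro polymatroid_mono[OF f'(1)]) auto
    moreover have "f' (?U (A \<union> B)) \<le> f' ((?U A \<union> Z') \<union> (?U B \<union> Z'))"
      using UT[OF A] UT[OF B] Z'T f'(2) by (intro polymatroid_mono[OF f'(1)]) auto
    ultimately show "f' Z' \<le> f (?U A) + f (?U B) - f (?U (A \<union> B))"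
      using f'(3) UT[of "A \<union> B"] A B by auto
    show "f (?U A) + f (?U B) - f (?U (A \<union> B)) \<le> f' Z'"
      unfolding Z(4)[symmetric] by (rule polymatroid_mono[OF f'(1) _ Z'T]) (auto simp: Z'_def)
  qed
  have gain': "f' (\<Union>(N' ` (insert z G - D'))) + d \<le> f' (\<Union>(N' ` (insert z G - D')) \<union> C)"
  proof (cases both)
    case True
    then have "insert z G - D' = G - D" using z by (auto simp: D'_def)
    then show ?thesis using N'[of "G - D"] gain f'(3) UT[of "G - D"] C by simp
  next
    case False
    \<comment> \<open>One of the two sets avoids \<open>D\<close>, so \<open>Z\<close> is spanned by the elements outside \<open>D\<close>.\<close>
    then obtain X where X: "X \<subseteq> G - D" "f' (?U X \<union> Z) = f (?U X)"
      using A B Z(2,3) unfolding both_def by blast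
    have "X \<subseteq> G" using X by blast
    then have "f' (?U X \<union> Z) = f' (?U X)" using X f'(3) UT by simp
    then have "f' (?U (G - D) \<union> Z) = f' (?U (G - D))"
      by (rule polymatroid_spans_mono[OF f'(1), rotated -1])
        (use X UT[of "G - D"] f'(2) Z(1) in auto)
    moreover have "f' (?U (G - D) \<union> C) \<le> f' (?U (G - D) \<union> Z \<union> C)"
      using UT[of "G - D"] f'(2) Z(1) C by (intro polymatroid_mono[OF f'(1)]) auto
    moreover have "insert z G - D' = (G - D) \<union> {z}" using False D z by (auto simp: D'_def)
    then have "\<Union>(N' ` (insert z G - D')) = ?U (G - D) \<union> Z"
      using N'z[of "G - D"] False by (simp add: Z'_def)
    ultimately show ?thesis using gain f'(3) UT[of "G - D"] C by simp
  qed
  have r': "reduced_aggregate T' f' (insert z G) N' D' C d h'"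
    unfolding reduced_aggregate_def
  proof (intro conjI ballI allI impI)
    show "N' x \<subseteq> T'" if "x \<in> insert z G" for x
      using that NT Z'T f'(2) by (auto simp: N'_def)
    show "f' (N' y \<union> C) = f' (N' y)" if "y \<in> D'" for y
    proof (cases "y = z")
      case True
      then have both using that D(2) by (auto simp: D'_def split: if_splits)
      then have "Z' \<union> C = Z'" by (auto simp: Z'_def)
      then show ?thesis using True by (simp add: N'_def)
    next
      case False
      then have y: "y \<in> D" using that by (auto simp: D'_def split: if_splits)
      then have "N y \<subseteq> T" using NT D by auto
      then show ?thesis using False y span f'(3) C by (simp add: N'_def)
    qed
    show "D' \<subseteq> insert z G" using D by (auto simp: D'_def)
    show "C \<subseteq> T'" using C f'(2) by blast
  qed (use fin gain' h'_def in auto)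
  have hX: "h' X = h X" if "X \<subseteq> G" for X
  proof -
    have "X \<inter> D' = X \<inter> D" using that z by (auto simp: D'_def)
    then show ?thesis using N'[OF that] f'(3)[OF UT[OF that]] h[OF that] by (simp add: h'_def)
  qed
  have hz: "h' (X \<union> {z}) = f' (?U X \<union> Z') - d * of_bool (both \<or> X \<inter> D \<noteq> {})" if "X \<subseteq> G" for X
  proof -
    have "(X \<union> {z}) \<inter> D' \<noteq> {} \<longleftrightarrow> both \<or> X \<inter> D \<noteq> {}" using D(2) by (auto simp: D'_def)
    then show ?thesis by (simp only: h'_def N'z[OF that])
  qed
  have "extension_step G h A B (insert z G) h'"
    unfolding extension_step_def
  proof (intro conjI exI[of _ "{z}"])
    show "polymatroid (insert z G) h'" by (rule polymatroid_reduced_aggregate[OF f'(1) r'])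
    show "h' (A \<union> {z}) = h A" using hz[OF A] h[OF A] sA both_def by auto
    show "h' (B \<union> {z}) = h B" using hz[OF B] h[OF B] sB both_def by auto
    have "A \<union> B \<subseteq> G" using A B by auto
    moreover have "(A \<union> B) \<inter> D \<noteq> {} \<longleftrightarrow> A \<inter> D \<noteq> {} \<or> B \<inter> D \<noteq> {}" by auto
    ultimately have "h (A \<union> B) = f (?U (A \<union> B)) - d * of_bool (A \<inter> D \<noteq> {} \<or> B \<inter> D \<noteq> {})"
      using h by simp
    then show "h' {z} = h A + h B - h (A \<union> B)"
      using hz[of "{}"] h[OF A] h[OF B] vZ both_def by auto
  qed (use hX in auto)
  with r' show ?thesis by blast
qed

lemma frac_modular_extendable_in_reduced_aggregate:
  fixes G :: "'c set"
  assumes inf: "infinite (UNIV :: 'c set)"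
  shows "frac_modular_extendable_in n T f \<Longrightarrow> reduced_aggregate T f G N D C d h
    \<Longrightarrow> frac_modular_extendable_in n G h"
proof (induction n arbitrary: T f G N D h)
  case 0
  then show ?case by (auto intro: polymatroid_reduced_aggregate)
next
  case (Suc n)
  have f: "polymatroid T f" using Suc.prems(1) by simp
  have NT: "\<Union>(N ` X) \<subseteq> T" if "X \<subseteq> G" for X
    using Suc.prems(2) that unfolding reduced_aggregate_def by blast
  have "\<exists>G' h'. extension_step G h A B G' h' \<and> frac_modular_extendable_in n G' h'"
    if A: "A \<subseteq> G" and B: "B \<subseteq> G" for A B
  proof -
    obtain T' f' where e: "extension_step T f (\<Union>(N ` A)) (\<Union>(N ` B)) T' f'"
      and n: "frac_modular_extendable_in n T' f'"
      using Suc.prems(1) NT[OF A] NT[OF B] unfolding frac_modular_extendable_in.simps by blast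
    have "finite G" using Suc.prems(2) by (simp add: reduced_aggregate_def)
    then obtain z where z: "z \<notin> G" using inf ex_new_if_finite by blast
    obtain Z where Z: "Z \<subseteq> T'" "f' (\<Union>(N ` A) \<union> Z) = f (\<Union>(N ` A))"
      "f' (\<Union>(N ` B) \<union> Z) = f (\<Union>(N ` B))"
      "f' Z = f (\<Union>(N ` A)) + f (\<Union>(N ` B)) - f (\<Union>(N ` A) \<union> \<Union>(N ` B))"
      using e unfolding extension_step_def by blast
    have vZ: "f' Z = f (\<Union>(N ` A)) + f (\<Union>(N ` B)) - f (\<Union>(N ` (A \<union> B)))"
      using Z(4) by (simp add: image_Un)
    have f': "polymatroid T' f'" "T \<subseteq> T'" "\<And>X. X \<subseteq> T \<Longrightarrow> f' X = f X"
      using e by (simp_all add: extension_step_def)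
    obtain N' D' h' where "reduced_aggregate T' f' (insert z G) N' D' C d h'"
      "extension_step G h A B (insert z G) h'"
      using extension_step_reduced_aggregate[OF f Suc.prems(2) A B z f' Z(1-3) vZ] by blast
    then show ?thesis using Suc.IH[OF n] by blast
  qed
  then show ?case using polymatroid_reduced_aggregate[OF f Suc.prems(2)] by auto
qed

text \<open>
  With singletons as values of \<open>N\<close> and an empty \<open>D\<close> the previous lemma moves a function to another
  type, restricts it, or replaces it by one that agrees with it on the ground set.
\<close>

lemma frac_modular_extendable_in_relabel:
  fixes G :: "'c set"
  assumes "infinite (UNIV :: 'c set)" "finite G" "frac_modular_extendable_in n T f"
    and "\<And>x. x \<in> G \<Longrightarrow> u x \<in> T" and "\<And>X. X \<subseteq> G \<Longrightarrow> h X = f (u ` X)"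
  shows "frac_modular_extendable_in n G h"
proof (rule frac_modular_extendable_in_reduced_aggregate[OF assms(1,3)])
  have "\<Union>((\<lambda>x. {u x}) ` X) = u ` X" for X by auto
  then show "reduced_aggregate T f G (\<lambda>x. {u x}) {} {} 0 h"
    using assms by (simp add: reduced_aggregate_def)
qed

section \<open>Tensor products with the uniform matroid of rank two\<close>

context
  fixes S :: "'a set" and \<phi> :: "'a set \<Rightarrow> real" and E :: "'b set" and \<psi> :: "('a \<times> 'b) set \<Rightarrow> real"
  assumes \<psi>: "\<psi> \<in> tensor_products S \<phi> E (uniform_rank 2)"
begin

lemma tensor_polymatroid: "polymatroid (S \<times> E) \<psi>"
  using \<psi> by (simp add: tensor_products_def)

lemma tensor_layer: "X \<subseteq> S \<Longrightarrow> e \<in> E \<Longrightarrow> \<psi> (X \<times> {e}) = \<phi> X"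
  using \<psi> by (simp add: tensor_products_def uniform_rank_def)

text \<open>
  The full layers \<open>S \<times> {e}\<close> and \<open>S \<times> {e'}\<close> have the joint value \<open>2 * \<phi> S\<close>, the sum of their own values.
  By submodularity this independence passes to their subsets.
\<close>

lemma tensor_layers_modular:
  assumes "X \<subseteq> S" "Y \<subseteq> S" "e \<in> E" "e' \<in> E" "e \<noteq> e'"
  shows "\<psi> (X \<times> {e} \<union> Y \<times> {e'}) = \<phi> X + \<phi> Y"
proof (rule antisym)
  note sub = polymatroid_submodular[OF tensor_polymatroid]
  have l: "\<psi> (X \<times> {e}) = \<phi> X" "\<psi> (Y \<times> {e'}) = \<phi> Y" "\<psi> (S \<times> {e}) = \<phi> S" "\<psi> (S \<times> {e'}) = \<phi> S"
    using assms by (simp_all add: tensor_layer)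
  have "X \<times> {e} \<inter> Y \<times> {e'} = {}" using assms by auto
  moreover have "\<psi> {} = 0" using tensor_polymatroid by (simp add: polymatroid_def)
  moreover have "X \<times> {e} \<subseteq> S \<times> E" "Y \<times> {e'} \<subseteq> S \<times> E" using assms by auto
  ultimately show "\<psi> (X \<times> {e} \<union> Y \<times> {e'}) \<le> \<phi> X + \<phi> Y"
    using sub[of "X \<times> {e}" "Y \<times> {e'}"] l by simp
  have "\<psi> (S \<times> {e, e'}) = 2 * \<phi> S"
    using \<psi> assms by (simp add: tensor_products_def uniform_rank_def)
  have 1: "(X \<times> {e} \<union> Y \<times> {e'}) \<inter> S \<times> {e} = X \<times> {e}"
     "(X \<times> {e} \<union> Y \<times> {e'}) \<union> S \<times> {e} = S \<times> {e} \<union> Y \<times> {e'}"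
     "(S \<times> {e} \<union> Y \<times> {e'}) \<inter> S \<times> {e'} = Y \<times> {e'}"
     "(S \<times> {e} \<union> Y \<times> {e'}) \<union> S \<times> {e'} = S \<times> {e, e'}"
    using assms by auto
  have 2: "X \<times> {e} \<union> Y \<times> {e'} \<subseteq> S \<times> E" "S \<times> {e} \<subseteq> S \<times> E" "S \<times> {e'} \<subseteq> S \<times> E"
     "S \<times> {e} \<union> Y \<times> {e'} \<subseteq> S \<times> E"
    using assms by auto
  have "\<psi> (X \<times> {e}) + \<psi> (S \<times> {e} \<union> Y \<times> {e'}) \<le> \<psi> (X \<times> {e} \<union> Y \<times> {e'}) + \<psi> (S \<times> {e})"
    using sub[OF 2(1,2)] unfolding 1 .
  moreover have "\<psi> (Y \<times> {e'}) + \<psi> (S \<times> {e, e'}) \<le> \<psi> (S \<times> {e} \<union> Y \<times> {e'}) + \<psi> (S \<times> {e'})"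
    using sub[OF 2(4,3)] unfolding 1 .
  ultimately show "\<phi> X + \<phi> Y \<le> \<psi> (X \<times> {e} \<union> Y \<times> {e'})"
    using l \<open>\<psi> (S \<times> {e, e'}) = 2 * \<phi> S\<close> by linarith
qed

lemma tensor_two_layers_span:
  assumes "X \<subseteq> S" "e \<in> E" "e' \<in> E" "e \<noteq> e'" "e'' \<in> E"
    and "X \<times> {e} \<subseteq> Y" "X \<times> {e'} \<subseteq> Y" "Y \<subseteq> S \<times> E"
  shows "\<psi> (Y \<union> X \<times> {e''}) = \<psi> Y"
proof (rule polymatroid_spans_mono[OF tensor_polymatroid])
  have "uniform_rank 2 {e, e', e''} = uniform_rank 2 {e, e'}"
    using \<open>e \<noteq> e'\<close> by (cases "e'' \<in> {e, e'}") (auto simp: uniform_rank_def card_insert_if)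
  then have "\<psi> (X \<times> {e, e', e''}) = \<psi> (X \<times> {e, e'})"
    using \<psi> assms by (simp add: tensor_products_def)
  moreover have "X \<times> {e, e', e''} = X \<times> {e, e'} \<union> X \<times> {e''}" by auto
  ultimately show "\<psi> (X \<times> {e, e'} \<union> X \<times> {e''}) = \<psi> (X \<times> {e, e'})" by simp
qed (use assms in auto)

text \<open>
  \<open>A \<times> {a}\<close> and \<open>A \<times> {c}\<close> span \<open>A \<times> {b}\<close>. Once this is added, \<open>A \<times> {c}\<close> in turn is spanned by the rest,
  and two independent layers \<open>A \<times> {a}\<close> and \<open>(A \<union> B) \<times> {b}\<close> remain.
\<close>

lemma tensor_three_layers:
  assumes "A \<subseteq> S" "B \<subseteq> S" "a \<in> E" "b \<in> E" "c \<in> E" "a \<noteq> b" "b \<noteq> c" "a \<noteq> c"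
  shows "\<psi> (A \<times> {c} \<union> A \<times> {a} \<union> B \<times> {b}) = \<phi> A + \<phi> (A \<union> B)"
proof -
  let ?Y = "A \<times> {c} \<union> A \<times> {a} \<union> B \<times> {b}"
  let ?W = "A \<times> {a} \<union> (A \<union> B) \<times> {b}"
  have "\<psi> ?Y = \<psi> (?Y \<union> A \<times> {b})"
    by (rule tensor_two_layers_span[of A c a, symmetric]) (use assms in auto)
  also have "?Y \<union> A \<times> {b} = ?W \<union> A \<times> {c}" by auto
  also have "\<psi> \<dots> = \<psi> ?W"
    by (rule tensor_two_layers_span[of A a b]) (use assms in auto)
  also have "\<dots> = \<phi> A + \<phi> (A \<union> B)"
    by (rule tensor_layers_modular) (use assms in auto)
  finally show ?thesis .
qed

text \<open>
  This is the condition that allows subtracting \<open>\<phi> (A \<union> B)\<close>: together with the diagonal layer \<open>c\<close>,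
  the set \<open>B \<times> {b}\<close> spans \<open>B \<times> {a}\<close>, so all of \<open>(A \<union> B) \<times> {a}\<close> is available, and it is independent of
  the diagonal.
\<close>

lemma tensor_diagonal_gain:
  assumes "A \<subseteq> S" "B \<subseteq> S" "a \<in> E" "b \<in> E" "c \<in> E" "a \<noteq> b" "b \<noteq> c" "a \<noteq> c"
  shows "\<phi> S + \<phi> (A \<union> B) \<le> \<psi> (S \<times> {c} \<union> (A \<times> {a} \<union> B \<times> {b}))"
proof -
  let ?Y = "S \<times> {c} \<union> (A \<times> {a} \<union> B \<times> {b})"
  have "\<phi> S + \<phi> (A \<union> B) = \<psi> (S \<times> {c} \<union> (A \<union> B) \<times> {a})"
    by (rule tensor_layers_modular[symmetric]) (use assms in auto)
  also have "\<dots> \<le> \<psi> (?Y \<union> B \<times> {a})"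
    by (rule polymatroid_mono[OF tensor_polymatroid]) (use assms in auto)
  also have "\<dots> = \<psi> ?Y"
    by (rule tensor_two_layers_span[of B c b]) (use assms in auto)
  finally show ?thesis .
qed

end

text \<open>
  The new element \<open>z\<close> stands for the intersection of \<open>W\<close> with the diagonal layer \<open>c\<close>; it is
  obtained by lowering \<open>W\<close> by \<open>\<phi> (A \<union> B)\<close>.
\<close>

lemma tensor_factor_frac_modular_extendable_in:
  fixes S :: "'a set" and E :: "'b set"
  assumes inf: "infinite (UNIV :: 'a set)" and fin: "finite S" and E: "card E = 3"
    and \<psi>: "\<psi> \<in> tensor_products S \<phi> E (uniform_rank 2)"
    and n: "frac_modular_extendable_in n (S \<times> E) \<psi>"
  shows "frac_modular_extendable_in (Suc n) S \<phi>"
proof -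
  obtain a b c where abc: "E = {a, b, c}" "a \<noteq> b" "b \<noteq> c" "a \<noteq> c"
    using E unfolding card_3_iff by blast
  have pair: "(\<lambda>x. (x, c)) ` X = X \<times> {c}" for X :: "'a set" by auto
  have "frac_modular_extendable_in 0 S \<phi>"
    by (rule frac_modular_extendable_in_relabel[OF inf fin, of _ "S \<times> E" \<psi> "\<lambda>x. (x, c)"])
      (use tensor_polymatroid[OF \<psi>] tensor_layer[OF \<psi>] abc in \<open>auto simp: pair\<close>)
  then have \<phi>: "polymatroid S \<phi>" by simp
  have "\<exists>S' \<phi>'. extension_step S \<phi> A B S' \<phi>' \<and> frac_modular_extendable_in n S' \<phi>'"
    if A: "A \<subseteq> S" and B: "B \<subseteq> S" for A B
  proof -
    obtain z where z: "z \<notin> S" using inf fin ex_new_if_finite by blast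
    define W where "W = A \<times> {a} \<union> B \<times> {b}"
    define N where "N = (\<lambda>x. {(x, c)})(z := W)"
    define h where "h X = \<psi> (\<Union>(N ` X)) - \<phi> (A \<union> B) * of_bool (X \<inter> {z} \<noteq> {})" for X
    have N: "\<Union>(N ` X) = X \<times> {c}" if "X \<subseteq> S" for X
      using that z by (force simp: N_def split: if_splits)
    have Nz: "\<Union>(N ` (X \<union> {z})) = X \<times> {c} \<union> W" if "X \<subseteq> S" for X
      unfolding image_Un Union_Un_distrib N[OF that] by (simp add: N_def)
    have W: "W \<subseteq> S \<times> E" using A B abc by (auto simp: W_def)
    have "insert z S - {z} = S" using z by auto
    then have "reduced_aggregate (S \<times> E) \<psi> (insert z S) N {z} W (\<phi> (A \<union> B)) h"
      using fin W N[of S] tensor_layer[OF \<psi>, of S c] tensor_diagonal_gain[OF \<psi> A B, of a b c] abc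
      by (auto simp: reduced_aggregate_def h_def N_def W_def)
    then have fh: "frac_modular_extendable_in n (insert z S) h"
      by (rule frac_modular_extendable_in_reduced_aggregate[OF inf n])
    have hX: "h X = \<phi> X" if "X \<subseteq> S" for X
      using N[OF that] tensor_layer[OF \<psi> that, of c] that z abc by (auto simp: h_def)
    have hz: "h (X \<union> {z}) = \<psi> (X \<times> {c} \<union> W) - \<phi> (A \<union> B)" if "X \<subseteq> S" for X
      unfolding h_def Nz[OF that] by simp
    have "extension_step S \<phi> A B (insert z S) h"
      unfolding extension_step_def
    proof (intro conjI exI[of _ "{z}"])
      show "polymatroid (insert z S) h" by (rule frac_modular_extendable_in_polymatroid[OF fh])
      show "h (A \<union> {z}) = \<phi> A"
        using hz[OF A] tensor_three_layers[OF \<psi> A B, of a b c] abc by (simp add: W_def Un_assoc)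
      show "h (B \<union> {z}) = \<phi> B"
        using hz[OF B] tensor_three_layers[OF \<psi> B A, of b a c] abc
        by (simp add: W_def Un_ac)
      show "h {z} = \<phi> A + \<phi> B - \<phi> (A \<union> B)"
        using hz[of "{}"] tensor_layers_modular[OF \<psi> A B, of a b] abc by (simp add: W_def)
    qed (use hX in auto)
    then show ?thesis using fh by blast
  qed
  then show ?thesis using \<phi> by simp
qed

section \<open>Iterated tensor products\<close>

text \<open>Extensions of functions on nested products need fresh elements in the type of nested products.\<close>

lemma infinite_UNIV_nested: "infinite (UNIV :: ('a, 'b) nested set)"
proof
  assume fin: "finite (UNIV :: ('a, 'b) nested set)"
  define s where "s x = Snoc x undefined" for x :: "('a, 'b) nested"
  have "inj s" by (simp add: inj_def s_def)
  then have "surj s" using fin finite_UNIV_inj_surj by blast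
  then obtain x where "Base undefined = s x" by (metis surjD)
  then show False by (simp add: s_def)
qed

lemma finite_iterated_ground: "finite S \<Longrightarrow> finite E \<Longrightarrow> finite (iterated_ground k S E)"
  by (induction k) auto

text \<open>
  The factors are removed from the outside. The number \<open>n\<close> is left general because each removed
  factor is paid back as one more extension step.
\<close>

lemma iterated_tensor_frac_modular_extendable:
  fixes S :: "'a set" and E :: "'b set"
  assumes fin: "finite S" and E: "card E = 3"
  shows "g \<in> iterated_tensor_products k S \<phi> E (uniform_rank 2)
    \<Longrightarrow> frac_modular_extendable_in n (iterated_ground k S E) g
    \<Longrightarrow> frac_modular_extendable (n + k) S \<phi>"
proof (induction k arbitrary: g n)
  case 0
  have inf: "infinite (UNIV :: ('a + nat) set)"
    by (simp add: finite_Plus_UNIV_iff)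
  have *: "\<phi> (Inl -` X) = g ((\<lambda>y. Base (projl y)) ` X)"
    if X: "X \<subseteq> Inl ` S" for X :: "('a + nat) set"
  proof -
    obtain Y where Y: "Y \<subseteq> S" "X = Inl ` Y" using X unfolding subset_image_iff by blast
    then have "(\<lambda>y. Base (projl y) :: ('a, 'b) nested) ` X = Base ` (Inl -` X)" by (auto simp: image_image)
    moreover have "Inl -` X \<subseteq> S" using Y by auto
    ultimately show ?thesis using 0(1) by auto
  qed
  show ?case unfolding frac_modular_extendable_def
    by (rule frac_modular_extendable_in_relabel[OF inf,
          of _ _ "Base ` S" g "\<lambda>y. Base (projl y)"])
      (use fin 0(2) * in auto)
next
  case (Suc k)
  let ?G = "iterated_ground k S E"
  let ?s = "\<lambda>(x, e). Snoc x e"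
  obtain \<phi>' where \<phi>': "\<phi>' \<in> iterated_tensor_products k S \<phi> E (uniform_rank 2)"
    and t: "(\<lambda>X. g (?s ` X)) \<in> tensor_products ?G \<phi>' E (uniform_rank 2)"
    using Suc.prems(1) by auto
  have finE: "finite E" using E by (metis card.infinite zero_neq_numeral)
  have finG: "finite ?G" using finite_iterated_ground fin finE by blast
  have inf: "infinite (UNIV :: (('a, 'b) nested \<times> 'b) set)"
    using infinite_UNIV_nested finite_prod by blast
  have "frac_modular_extendable_in n (?G \<times> E) (\<lambda>X. g (?s ` X))"
    by (rule frac_modular_extendable_in_relabel[OF inf _ Suc.prems(2), of _ ?s])
      (use finG finE in auto)
  then have "frac_modular_extendable_in (Suc n) ?G \<phi>'"
    by (rule tensor_factor_frac_modular_extendable_in[OF infinite_UNIV_nested finG E t])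
  from Suc.IH[OF \<phi>' this] show ?case by simp
qed

theorem theorem5p16:
  fixes k :: nat
    and S :: "'a set"
    and \<phi> :: "'a set \<Rightarrow> real"
    and E :: "'b set"
  assumes "k \<ge> 1"
    and "finite S"
    and "polymatroid S \<phi>"
    and "card E = 3"
    and "tensor_compatible k S \<phi> E (uniform_rank 2)"
  shows "frac_modular_extendable k S \<phi>"
proof -
  obtain g where g: "g \<in> iterated_tensor_products k S \<phi> E (uniform_rank 2)"
    using assms(5) by (auto simp: tensor_compatible_def)
  obtain j where k: "k = Suc j" using assms(1) by (cases k) auto
  let ?s = "\<lambda>(x, e). Snoc x e :: ('a, 'b) nested"
  let ?G = "iterated_ground j S E"
  have p: "polymatroid (?G \<times> E) (\<lambda>X. g (?s ` X))"
    using g by (auto simp: k tensor_products_def)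
  have "frac_modular_extendable_in 0 (iterated_ground k S E) g"
  proof (rule frac_modular_extendable_in_relabel[OF infinite_UNIV_nested,
        of _ _ "?G \<times> E" "\<lambda>X. g (?s ` X)" "inv ?s"])
    have inj: "inj ?s" by (auto simp: inj_def)
    show "finite (iterated_ground k S E)" using p by (auto simp: k polymatroid_def)
    show "inv ?s x \<in> ?G \<times> E" if "x \<in> iterated_ground k S E" for x
      using that inv_f_f[OF inj] by (force simp: k)
    show "g X = g (?s ` (inv ?s ` X))" if "X \<subseteq> iterated_ground k S E" for X
    proof -
      have "X \<subseteq> range ?s" using that by (auto simp: k)
      then show ?thesis by (metis image_f_inv_f image_inv_into_cancel)
    qed
  qed (use p in simp)
  from iterated_tensor_frac_modular_extendable[OF assms(2,4) g this]
  show ?thesis by simp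
qed

end
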